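(* There exist absolute constants $C>0$ and $\tau_0\in(0,1)$ such that the following holds. Let $0<\tau\le\tau_0$ and let $\check z_{-L}<0<\check z_{R}$ be real end points with $\max\{1-\Phi(\check z_R),\,\Phi(\check z_{-L})\}\le\tau$. Then there is a valid array of breakpoints $\check{\boldsymbol z}$ whose smallest element is $\check z_{-L}$ and whose largest element is $\check z_R$, consisting of at most $C\,\tfrac{1}{\sqrt\tau}\sqrt{\log\tfrac1\tau}$ breakpoints, such that $$0\le \Phi(z)-\underline\Phi(z;\check{\boldsymbol z})\le\tau\qquad\text{for all } z\in\mathbb R.$$
   Context: $\Phi$ and $\phi$ denote the cumulative distribution function and the density of the standard normal distribution. For integers $m\ge 1$, $[m]=\{1,\dots,m\}$ and $[m]_0=\{0,1,\dots,m\}$. A valid array of breakpoints is a vector $\check{\boldsymbol z}=(\check z_{-L},\dots,\check z_{-1},\check z_0,\check z_1,\dots,\check z_R)\in\mathbb R^{L+R+1}$, with integers $L,R>0$, such that $-\infty<\check z_{-L}<\dots<\check z_{-1}<\check z_0=0<\check z_1<\dots<\check z_R<\infty$; its number of breakpoints is $L+R+1$. The integers $L$ and $R$ are part of the choice of the array; only the values of the two end points are prescribed in the claim. The piecewise linear inner approximation of $\Phi$ associated with $\check{\boldsymbol z}$ is $$\underline\Phi(z;\check{\boldsymbol z})=\begin{cases}\min\{\Phi(\check z_R),\ \min_{i\in[R]}(g_i z+g_i^0)\}, & z\ge 0,\\ \max\{0,\ \max_{i\in[L]_0}(h_i z+h_i^0)\}, & z<0,\end{cases}$$ where $g_i=\frac{\Phi(\check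 z_i)-\Phi(\check z_{i-1})}{\check z_i-\check z_{i-1}}$ and $g_i^0=\Phi(\check z_{i-1})-g_i\check z_{i-1}$ for $i\in[R]$ (secants), and $h_i=\phi(\check z_{-i})$ and $h_i^0=\Phi(\check z_{-i})-\phi(\check z_{-i})\check z_{-i}$ for $i\in[L]_0$ (tangents). *)

theory Defs
  imports "HOL-Probability.Probability"
begin

abbreviation std_normal_cdf :: "real \<Rightarrow> real" where
  "std_normal_cdf \<equiv> cdf std_normal_distribution"

text \<open>An array of breakpoints is a function on the integers of which only the values at the
  indices from \<open>- L\<close> to \<open>R\<close> matter; its number of breakpoints is \<open>L + R + 1\<close>.\<close>

definition valid_breakpoints :: "nat \<Rightarrow> nat \<Rightarrow> (int \<Rightarrow> real) \<Rightarrow> bool" where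
  "valid_breakpoints L R b \<longleftrightarrow>
     0 < L \<and> 0 < R \<and> b 0 = 0 \<and> strict_mono_on {- int L..int R} b"

definition secant_slope :: "(int \<Rightarrow> real) \<Rightarrow> int \<Rightarrow> real" where
  "secant_slope b i =
     (std_normal_cdf (b i) - std_normal_cdf (b (i - 1))) / (b i - b (i - 1))"

definition secant_intercept :: "(int \<Rightarrow> real) \<Rightarrow> int \<Rightarrow> real" where
  "secant_intercept b i = std_normal_cdf (b (i - 1)) - secant_slope b i * b (i - 1)"

definition tangent_slope :: "(int \<Rightarrow> real) \<Rightarrow> int \<Rightarrow> real" where
  "tangent_slope b i = std_normal_density (b (- i))"

definition tangent_intercept :: "(int \<Rightarrow> real) \<Rightarrow> int \<Rightarrow> real" where
  "tangent_intercept b i =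
     std_normal_cdf (b (- i)) - std_normal_density (b (- i)) * b (- i)"

definition inner_approx :: "nat \<Rightarrow> nat \<Rightarrow> (int \<Rightarrow> real) \<Rightarrow> real \<Rightarrow> real" where
  "inner_approx L R b z =
     (if 0 \<le> z
      then min (std_normal_cdf (b (int R)))
             (Min ((\<lambda>i. secant_slope b i * z + secant_intercept b i) ` {1..int R}))
      else max 0
             (Max ((\<lambda>i. tangent_slope b i * z + tangent_intercept b i) ` {0..int L})))"

end

theory Submission
  imports Defs "HOL-Real_Asymp.Real_Asymp"
begin

text \<open>On both half lines take a uniform grid of step \<open>sqrt \<tau>\<close> up to
  \<open>M = sqrt (2 * ln (1 / \<tau>))\<close>, and reach the prescribed end point by one last, possibly long,
  interval. The density is 1-Lipschitz, so on a short interval secant and tangent deviate from the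
  cdf by at most the squared length \<open>\<tau>\<close>; beyond \<open>M\<close> the tail of the cdf is itself at
  most \<open>\<tau>\<close>, so the length of the last interval is irrelevant.\<close>

section \<open>The standard normal cdf and density\<close>

interpretation std_normal: real_distribution std_normal_distribution
  by (rule real_dist_normal_dist)

text \<open>Passes from the distribution to a gauge integral over a closed interval, the form that
  the fundamental theorem of calculus requires.\<close>

lemma std_normal_cdf_diff:
  assumes "a \<le> b"
  shows "std_normal_cdf b - std_normal_cdf a = integral {a..b} std_normal_density"
proof -
  have "std_normal_cdf b - std_normal_cdf a = measure std_normal_distribution {a<..b}"
    using std_normal.cdf_diff_eq[of a b] assms by (cases "a = b") auto
  also have "\<dots> = (LINT x|std_normal_distribution. indicator {a<..b} x)"
    by simp
  also have "\<dots> = (LINT x:{a<..b}|lborel. std_normal_density x)"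
    by (subst integral_density)
      (auto simp: set_lebesgue_integral_def mult.commute intro!: AE_I2)
  also have "\<dots> = integral {a<..b} std_normal_density"
    by (rule set_borel_integral_eq_integral)
      (auto simp: set_integrable_def
        intro!: integrable_mult_indicator[where 'b = real, simplified] integrable_normal_density)
  also have "\<dots> = integral {a..b} std_normal_density"
    by (rule integral_subset_negligible) (auto intro: negligible_subset[of "{a}"])
  finally show ?thesis .
qed

lemma DERIV_std_normal_density:
  "(std_normal_density has_real_derivative - x * std_normal_density x) (at x)"
  unfolding std_normal_density_def
  by (auto intro!: derivative_eq_intros simp: field_simps power2_eq_square)

lemma DERIV_std_normal_cdf:
  "(std_normal_cdf has_real_derivative std_normal_density x) (at x)"
proof -
  \<comment> \<open>The base point \<open>x - 1\<close> makes \<open>x\<close> interior to the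
    interval, so the derivative within it is a full derivative.\<close>
  have "continuous_on {x - 1..x + 1} std_normal_density"
    by (intro continuous_at_imp_continuous_on ballI DERIV_isCont[OF DERIV_std_normal_density])
  then have "((\<lambda>u. std_normal_cdf (x - 1) + integral {x - 1..u} std_normal_density)
      has_real_derivative 0 + std_normal_density x) (at x within {x - 1..x + 1})"
    by (intro DERIV_add DERIV_const integral_has_real_derivative) auto
  then have deriv: "((\<lambda>u. std_normal_cdf (x - 1) + integral {x - 1..u} std_normal_density)
      has_real_derivative std_normal_density x) (at x)"
    by (subst (asm) at_within_interior) auto
  have eq: "std_normal_cdf (x - 1) + integral {x - 1..u} std_normal_density = std_normal_cdf u"
    if "u \<in> {x - 1<..<x + 1}" for u
    using std_normal_cdf_diff[of "x - 1" u] that by simp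
  show ?thesis
    by (rule has_field_derivative_transform_within_open[OF deriv, of "{x - 1<..<x + 1}"])
      (simp_all add: eq)
qed

text \<open>Stands in for curvature: the derivative of the cdf increases on the left half line
  (convexity, for tangents) and decreases on the right one (concavity, for secants).\<close>

lemma std_normal_density_mono_abs:
  assumes "\<bar>y\<bar> \<le> \<bar>x\<bar>"
  shows "std_normal_density x \<le> std_normal_density y"
proof -
  have "y\<^sup>2 \<le> x\<^sup>2"
    using assms by (simp add: abs_le_square_iff)
  then show ?thesis
    by (simp add: std_normal_density_def divide_right_mono)
qed

lemma std_normal_density_le_exp: "std_normal_density x \<le> exp (- x\<^sup>2 / 2)"
proof -
  have "1 \<le> sqrt (2 * pi)"
    using pi_gt3 by simp
  then have "1 / sqrt (2 * pi) \<le> 1"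
    by simp
  then show ?thesis
    unfolding std_normal_density_def by (rule mult_left_le_one_le[rotated 2]) auto
qed

text \<open>The derivative is \<open>- t * std_normal_density t\<close>, and the bound
  \<open>exp (t\<^sup>2 / 2)\<close> on \<open>\<bar>t\<bar>\<close> cancels the Gaussian
  factor.\<close>

lemma std_normal_density_Lipschitz:
  "\<bar>std_normal_density x - std_normal_density y\<bar> \<le> \<bar>x - y\<bar>"
proof -
  have "\<bar>t * std_normal_density t\<bar> \<le> 1" for t :: real
  proof -
    have "\<bar>t\<bar> \<le> 1 + t\<^sup>2 / 2"
      using zero_le_power2[of "\<bar>t\<bar> - 1"] by (simp add: power2_diff)
    also have "\<dots> \<le> exp (t\<^sup>2 / 2)"
      by (rule exp_ge_add_one_self)
    finally have "\<bar>t\<bar> * exp (- t\<^sup>2 / 2) \<le> exp (t\<^sup>2 / 2) * exp (- t\<^sup>2 / 2)"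
      by (intro mult_right_mono) auto
    also have "\<dots> = 1"
      by (simp flip: exp_add)
    finally show ?thesis
      using mult_left_mono[OF std_normal_density_le_exp[of t], of "\<bar>t\<bar>"]
      by (simp add: abs_mult)
  qed
  then have "norm (std_normal_density x - std_normal_density y) \<le> 1 * norm (x - y)"
    by (intro field_differentiable_bound[where S = UNIV and f' = "\<lambda>t. - t * std_normal_density t"])
      (use DERIV_std_normal_density in \<open>auto intro: DERIV_subset\<close>)
  then show ?thesis
    by simp
qed

text \<open>Where \<open>\<bar>t\<bar> \<ge> 1\<close>, the density is at most \<open>\<bar>t\<bar> * exp (- t\<^sup>2 / 2)\<close>, whose tail
  integral is \<open>exp (- x\<^sup>2 / 2)\<close>.\<close>

lemma std_normal_cdf_upper_tail:
  assumes "1 \<le> x"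
  shows "1 - std_normal_cdf x \<le> exp (- x\<^sup>2 / 2)"
proof -
  let ?g = "\<lambda>t. exp (- t\<^sup>2 / 2) + std_normal_cdf t"
  have lim: "(?g \<longlongrightarrow> 0 + 1) at_top"
    by (intro tendsto_add std_normal.cdf_lim_at_top_prob) real_asymp
  \<comment> \<open>Since \<open>?g\<close> does not increase beyond \<open>x\<close> and tends to
    1, its value at \<open>x\<close> is at least 1, which is the claim.\<close>
  have "?g y \<le> ?g x" if "x \<le> y" for y
  proof (rule DERIV_nonpos_imp_nonincreasing[OF that])
    fix t assume "x \<le> t" "t \<le> y"
    then have "1 * exp (- t\<^sup>2 / 2) \<le> t * exp (- t\<^sup>2 / 2)"
      using assms by (intro mult_right_mono) auto
    then have "std_normal_density t \<le> t * exp (- t\<^sup>2 / 2)"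
      using std_normal_density_le_exp[of t] by linarith
    moreover have "(?g has_real_derivative - t * exp (- t\<^sup>2 / 2) + std_normal_density t) (at t)"
      by (auto intro!: derivative_eq_intros DERIV_std_normal_cdf simp: power2_eq_square)
    ultimately show "\<exists>d. (?g has_real_derivative d) (at t) \<and> d \<le> 0"
      by (intro exI conjI) auto
  qed
  then have "1 \<le> ?g x"
    using tendsto_upperbound[OF lim, of "?g x"] eventually_mono[OF eventually_ge_at_top[of x]]
    by simp
  then show ?thesis
    by simp
qed

text \<open>Mirror image of the upper tail: here \<open>?g\<close> does not decrease up to
  \<open>x\<close> and tends to 0 at minus infinity.\<close>

lemma std_normal_cdf_lower_tail:
  assumes "x \<le> - 1"
  shows "std_normal_cdf x \<le> exp (- x\<^sup>2 / 2)"
proof -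
  let ?g = "\<lambda>t. exp (- t\<^sup>2 / 2) - std_normal_cdf t"
  have lim: "(?g \<longlongrightarrow> 0 - 0) at_bot"
    by (intro tendsto_diff std_normal.cdf_lim_at_bot) real_asymp
  have "?g y \<le> ?g x" if "y \<le> x" for y
  proof (rule DERIV_nonneg_imp_nondecreasing[OF that])
    fix t assume "y \<le> t" "t \<le> x"
    then have "1 * exp (- t\<^sup>2 / 2) \<le> - t * exp (- t\<^sup>2 / 2)"
      using assms by (intro mult_right_mono) auto
    then have "std_normal_density t \<le> - t * exp (- t\<^sup>2 / 2)"
      using std_normal_density_le_exp[of t] by linarith
    moreover have "(?g has_real_derivative - t * exp (- t\<^sup>2 / 2) - std_normal_density t) (at t)"
      by (auto intro!: derivative_eq_intros DERIV_std_normal_cdf simp: power2_eq_square)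
    ultimately show "\<exists>d. (?g has_real_derivative d) (at t) \<and> 0 \<le> d"
      by (intro exI conjI) auto
  qed
  then have "0 \<le> ?g x"
    using tendsto_upperbound[OF lim, of "?g x"] eventually_mono[OF eventually_le_at_bot[of x]]
    by simp
  then show ?thesis
    by simp
qed

lemma std_normal_cdf_MVT:
  assumes "a < b"
  obtains t where "a < t" "t < b"
    "std_normal_cdf b - std_normal_cdf a = (b - a) * std_normal_density t"
  using MVT2[OF assms, of std_normal_cdf std_normal_density] DERIV_std_normal_cdf by blast

section \<open>Secants and tangents\<close>

text \<open>Convexity on the left half line: the mean value density between \<open>c\<close> and
  \<open>z\<close> is compared with the density at \<open>c\<close>.\<close>

lemma tangent_le_std_normal_cdf:
  assumes "c \<le> 0" "z \<le> 0"
  shows "std_normal_density c * z + (std_normal_cdf c - std_normal_density c * c)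
    \<le> std_normal_cdf z"
proof (cases c z rule: linorder_cases)
  case less
  then obtain t where t: "c < t" "t < z"
    "std_normal_cdf z - std_normal_cdf c = (z - c) * std_normal_density t"
    by (rule std_normal_cdf_MVT)
  then have "(z - c) * std_normal_density c \<le> (z - c) * std_normal_density t"
    using assms by (intro mult_left_mono std_normal_density_mono_abs) auto
  then show ?thesis
    using t by (simp add: algebra_simps)
next
  case greater
  then obtain t where t: "z < t" "t < c"
    "std_normal_cdf c - std_normal_cdf z = (c - z) * std_normal_density t"
    by (rule std_normal_cdf_MVT)
  then have "(c - z) * std_normal_density t \<le> (c - z) * std_normal_density c"
    using assms by (intro mult_left_mono std_normal_density_mono_abs) auto
  then show ?thesis
    using t by (simp add: algebra_simps)
qed (simp add: algebra_simps)

text \<open>By the mean value theorem the gap is \<open>z - c\<close> times a difference of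
  densities at points at most \<open>h\<close> apart; the Lipschitz bound makes both factors at most
  \<open>h\<close>.\<close>

lemma std_normal_cdf_minus_tangent_le:
  assumes "c \<le> z" "z \<le> c + h"
  shows "std_normal_cdf z - (std_normal_density c * z + (std_normal_cdf c - std_normal_density c * c))
    \<le> h\<^sup>2"
proof (cases "c = z")
  case False
  then obtain t where t: "c < t" "t < z"
    "std_normal_cdf z - std_normal_cdf c = (z - c) * std_normal_density t"
    using assms std_normal_cdf_MVT[of c z] by auto
  have "(z - c) * (std_normal_density t - std_normal_density c) \<le> (z - c) * h"
    using std_normal_density_Lipschitz[of t c] t assms by (intro mult_left_mono) auto
  also have "\<dots> \<le> h * h"
    using t assms by (intro mult_right_mono) auto
  finally have "(z - c) * (std_normal_density t - std_normal_density c) \<le> h * h" .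
  then show ?thesis
    using t by (simp add: algebra_simps power2_eq_square)
qed (simp add: algebra_simps)

text \<open>Concavity on the right half line, with the slope \<open>s\<close> realised as the
  density at an intermediate point. The last fact ignores the length of the interval and serves the
  long interval in the tail.\<close>

lemma
  assumes "0 \<le> a" "a < b" "0 \<le> z"
  defines "s \<equiv> (std_normal_cdf b - std_normal_cdf a) / (b - a)"
  shows std_normal_cdf_le_secant:
      "z \<le> a \<or> b \<le> z \<Longrightarrow> std_normal_cdf z \<le> s * z + (std_normal_cdf a - s * a)"
    and secant_le_std_normal_cdf:
      "a \<le> z \<Longrightarrow> z \<le> b \<Longrightarrow> s * z + (std_normal_cdf a - s * a) \<le> std_normal_cdf z"
    and std_normal_cdf_minus_secant_le:
      "a \<le> z \<Longrightarrow> z \<le> b \<Longrightarrow> std_normal_cdf z - (s * z + (std_normal_cdf a - s * a)) \<le> (b - a)\<^sup>2"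
    and secant_ge_left_value:
      "a \<le> z \<Longrightarrow> std_normal_cdf a \<le> s * z + (std_normal_cdf a - s * a)"
proof -
  obtain t where t: "a < t" "t < b"
    "std_normal_cdf b - std_normal_cdf a = (b - a) * std_normal_density t"
    using assms by (auto elim: std_normal_cdf_MVT)
  then have s: "s = std_normal_density t"
    using assms by (simp add: s_def)
  \<comment> \<open>The same secant based at \<open>b\<close>, for comparisons to the right of
    \<open>b\<close>.\<close>
  have at_b: "s * z + (std_normal_cdf a - s * a) = std_normal_cdf b + s * (z - b)"
    using t by (simp add: s algebra_simps)
  {
    assume "a \<le> z"
    then have "0 \<le> s * (z - a)"
      by (simp add: s)
    then show "std_normal_cdf a \<le> s * z + (std_normal_cdf a - s * a)"
      by (simp add: algebra_simps)
  }
  {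
    assume "z \<le> a \<or> b \<le> z"
    then consider "z < a" | "b < z" | "z = a" | "z = b"
      by linarith
    then show "std_normal_cdf z \<le> s * z + (std_normal_cdf a - s * a)"
    proof cases
      case 1
      then obtain u where u: "z < u" "u < a"
        "std_normal_cdf a - std_normal_cdf z = (a - z) * std_normal_density u"
        by (rule std_normal_cdf_MVT)
      then have "(a - z) * s \<le> (a - z) * std_normal_density u"
        unfolding s using t assms by (intro mult_left_mono std_normal_density_mono_abs) auto
      then show ?thesis
        using u by (simp add: algebra_simps)
    next
      case 2
      then obtain u where u: "b < u" "u < z"
        "std_normal_cdf z - std_normal_cdf b = (z - b) * std_normal_density u"
        by (rule std_normal_cdf_MVT)
      then have "(z - b) * std_normal_density u \<le> (z - b) * s"
        unfolding s using t assms by (intro mult_left_mono std_normal_density_mono_abs) auto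
      then show ?thesis
        unfolding at_b using u by (simp add: algebra_simps)
    qed (use at_b in auto)
  }
  assume z: "a \<le> z" "z \<le> b"
  consider "z = a" | "z = b" | "a < z" "z < b"
    using z by linarith
  then have "s * z + (std_normal_cdf a - s * a) \<le> std_normal_cdf z \<and>
    std_normal_cdf z - (s * z + (std_normal_cdf a - s * a)) \<le> (b - a)\<^sup>2"
  proof cases
    case 3
    obtain u where u: "a < u" "u < z"
      "std_normal_cdf z - std_normal_cdf a = (z - a) * std_normal_density u"
      using 3 by (auto elim: std_normal_cdf_MVT)
    obtain v where v: "z < v" "v < b"
      "std_normal_cdf b - std_normal_cdf z = (b - z) * std_normal_density v"
      using 3 by (auto elim: std_normal_cdf_MVT)
    have "std_normal_density v \<le> std_normal_density u"
      using u v assms by (intro std_normal_density_mono_abs) auto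
    \<comment> \<open>The chord over \<open>[a, z]\<close> is at least as steep as the one over
      \<open>[z, b]\<close>. Cleared of denominators, this says that \<open>b - a\<close> times the
      gap is nonnegative.\<close>
    then have "0 \<le> (b - z) * (z - a) * (std_normal_density u - std_normal_density v)"
      using 3 by simp
    also have "\<dots> = (b - z) * ((z - a) * std_normal_density u)
        - (z - a) * ((b - z) * std_normal_density v)"
      by (simp add: algebra_simps)
    also have "\<dots> = (b - a) * (std_normal_cdf z - std_normal_cdf a)
        - (z - a) * (std_normal_cdf b - std_normal_cdf a)"
      unfolding u(3)[symmetric] v(3)[symmetric] by (simp add: algebra_simps)
    also have "\<dots> = (b - a) * (std_normal_cdf z - (s * z + (std_normal_cdf a - s * a)))"
      unfolding t(3) s by (simp add: algebra_simps)
    finally have "s * z + (std_normal_cdf a - s * a) \<le> std_normal_cdf z"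
      using assms by (simp add: zero_le_mult_iff)
    moreover have "(z - a) * (std_normal_density u - std_normal_density t) \<le> (b - a) * (b - a)"
    proof -
      have "(z - a) * (std_normal_density u - std_normal_density t) \<le> (z - a) * (b - a)"
        using std_normal_density_Lipschitz[of u t] t u 3 by (intro mult_left_mono) linarith+
      also have "\<dots> \<le> (b - a) * (b - a)"
        using 3 by (intro mult_right_mono) auto
      finally show ?thesis .
    qed
    ultimately show ?thesis
      using u(3) by (simp add: s algebra_simps power2_eq_square)
  qed (use at_b in auto)
  then show "s * z + (std_normal_cdf a - s * a) \<le> std_normal_cdf z"
    and "std_normal_cdf z - (s * z + (std_normal_cdf a - s * a)) \<le> (b - a)\<^sup>2"
    by auto
qed

section \<open>The breakpoints\<close>

text \<open>The bound on \<open>n\<close> does not depend on \<open>T\<close>: only the last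
  interval can be long, and then it starts at or beyond \<open>M\<close>.\<close>

lemma half_line_grid:
  fixes h M T :: real
  assumes "0 < h" "0 < M" "0 < T"
  obtains n :: nat and x :: "nat \<Rightarrow> real"
  where "0 < n" "real n \<le> M / h + 2" "x 0 = 0" "x n = T" "strict_mono_on {0..n} x"
    "\<And>i. i < n \<Longrightarrow> x (Suc i) - x i \<le> h \<or> M \<le> x i"
proof
  define m where "m = nat \<lceil>M / h\<rceil>"
  define k where "k = nat \<lceil>T / h\<rceil>"
  \<comment> \<open>If \<open>n = k\<close>, the last interval has length at most \<open>h\<close>,
    because \<open>k\<close> steps reach \<open>T\<close>. If \<open>n = Suc m\<close>, it starts at
    \<open>real m * h\<close>, which is at least \<open>M\<close>.\<close>
  define n where "n = min k (Suc m)"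
  define x where "x = (\<lambda>i. if i < n then real i * h else T)"
  have nat_ceiling: "u \<le> real (nat \<lceil>u / h\<rceil>) * h" "real (nat \<lceil>u / h\<rceil>) < u / h + 1"
    if "0 < u" for u
  proof -
    have "u / h \<le> real (nat \<lceil>u / h\<rceil>)"
      by (rule of_nat_ceiling)
    then show "u \<le> real (nat \<lceil>u / h\<rceil>) * h"
      using assms(1) by (simp only: pos_divide_le_eq)
    have "0 < u / h"
      using assms(1) that by simp
    then show "real (nat \<lceil>u / h\<rceil>) < u / h + 1"
      by linarith
  qed
  have k: "T \<le> real k * h" "real k < T / h + 1" "0 < k"
    using assms nat_ceiling[of T] by (auto simp: k_def)
  have m: "M \<le> real m * h" "real m < M / h + 1"
    using assms nat_ceiling[of M] by (auto simp: m_def)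
  show "0 < n"
    using k by (simp add: n_def)
  then show "x 0 = 0" "x n = T"
    by (auto simp: x_def)
  show "real n \<le> M / h + 2"
    using m unfolding n_def by linarith
  \<comment> \<open>The strict upper bound on the ceiling keeps grid points strictly below
    \<open>T\<close>, hence strict monotonicity at the last step.\<close>
  have below: "real i * h < T" if "i < n" for i
  proof -
    have "real i \<le> real k - 1"
      using that unfolding n_def by linarith
    then have "real i < T / h"
      using k by linarith
    then show ?thesis
      using assms by (simp add: field_simps)
  qed
  then show "strict_mono_on {0..n} x"
    using assms by (auto simp: x_def strict_mono_on_def)
  fix i assume "i < n"
  show "x (Suc i) - x i \<le> h \<or> M \<le> x i"
  proof (cases "Suc i < n")
    case True
    then show ?thesis
      by (auto simp: x_def algebra_simps)
  next
    case False
    then have "Suc i = n"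
      using \<open>i < n\<close> by simp
    then have "k = Suc i \<or> i = m"
      unfolding n_def by linarith
    then show ?thesis
      using \<open>Suc i = n\<close> k m by (auto simp: x_def algebra_simps)
  qed
qed

lemma ex_interval_containing:
  fixes x :: "nat \<Rightarrow> real"
  assumes "x 0 \<le> z" "z \<le> x n" "0 < n"
  obtains i where "i < n" "x i \<le> z" "z \<le> x (Suc i)"
proof -
  have "\<exists>i<n. x i \<le> z \<and> z \<le> x (Suc i)"
    using assms(2,3)
  proof (induction n)
    case (Suc n)
    show ?case
    proof (cases "z \<le> x n \<and> 0 < n")
      \<comment> \<open>The induction hypothesis needs \<open>0 < n\<close>. Otherwise the last
        interval works, its left end being below \<open>z\<close> either directly or as
        \<open>x 0\<close>.\<close>
      case True
      then show ?thesis
        using Suc.IH by (auto intro: less_SucI)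
    next
      case False
      then show ?thesis
        using Suc.prems assms(1) by (intro exI[of _ n]) auto
    qed
  qed simp
  then show ?thesis
    using that by blast
qed

text \<open>The sequence \<open>y\<close> lists the absolute values of the left breakpoints, so that
  both sides come from the same grid construction.\<close>

definition glue :: "(nat \<Rightarrow> real) \<Rightarrow> (nat \<Rightarrow> real) \<Rightarrow> int \<Rightarrow> real" where
  "glue x y i = (if 0 \<le> i then x (nat i) else - y (nat (- i)))"

lemma valid_breakpoints_glue:
  assumes "0 < L" "0 < R" "x 0 = 0" "y 0 = 0"
    and x: "strict_mono_on {0..R} x" and y: "strict_mono_on {0..L} y"
  shows "valid_breakpoints L R (glue x y)"
proof -
  have "glue x y i < glue x y j" if "- int L \<le> i" "i < j" "j \<le> int R" for i j
  proof -
    have nonneg: "0 \<le> x (nat j)" if "0 \<le> j"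
      using strict_mono_onD[OF x, of 0 "nat j"] \<open>j \<le> int R\<close> that assms
      by (cases "j = 0") (auto simp: nat_le_iff)
    have pos: "0 < y (nat (- i))" if "i < 0"
      using strict_mono_onD[OF y, of 0 "nat (- i)"] \<open>- int L \<le> i\<close> that assms by auto
    consider "0 \<le> i" | "i < 0" "0 \<le> j" | "j < 0"
      by linarith
    then show ?thesis
    proof cases
      case 1
      then show ?thesis
        using that strict_mono_onD[OF x, of "nat i" "nat j"] by (auto simp: glue_def)
    next
      case 2
      then show ?thesis
        using nonneg pos by (simp add: glue_def)
    next
      case 3
      then show ?thesis
        using that strict_mono_onD[OF y, of "nat (- j)" "nat (- i)"] by (auto simp: glue_def)
    qed
  qed
  then show ?thesis
    using assms by (auto simp: valid_breakpoints_def strict_mono_on_def glue_def)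
qed

section \<open>Approximation error on each half line\<close>

text \<open>A minimum is small as soon as one line is, so the secant over the interval containing
  \<open>z\<close>, or the cap beyond \<open>x R\<close>, gives the lower bound on the error. The
  upper bound has to be checked for every secant and for the cap.\<close>

lemma inner_approx_error_nonneg_side:
  assumes R: "0 < R" and b: "\<And>i. i \<le> R \<Longrightarrow> b (int i) = x i"
    and x: "strict_mono_on {0..R} x" "x 0 = 0"
    and gap: "\<And>i. i < R \<Longrightarrow> (x (Suc i) - x i)\<^sup>2 \<le> \<tau> \<or> 1 - std_normal_cdf (x i) \<le> \<tau>"
    and end_tail: "1 - std_normal_cdf (x R) \<le> \<tau>" and z: "0 \<le> z"
  shows "0 \<le> std_normal_cdf z - inner_approx L R b z"
    and "std_normal_cdf z - inner_approx L R b z \<le> \<tau>"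
proof -
  define l where "l = (\<lambda>i. secant_slope b i * z + secant_intercept b i)"
  define s where "s = (\<lambda>i. (std_normal_cdf (x (Suc i)) - std_normal_cdf (x i)) / (x (Suc i) - x i))"
  have "0 \<le> \<tau>"
    using end_tail std_normal.cdf_bounded_prob[of "x R"] by linarith
  \<comment> \<open>Index shift: secants are numbered by the right end of their interval,
    \<open>s\<close> by the left end.\<close>
  have l: "l (int (Suc i)) = s i * z + (std_normal_cdf (x i) - s i * x i)" if "i < R" for i
    using that b[of i] b[of "Suc i"]
    by (simp add: l_def s_def secant_slope_def secant_intercept_def)
  have step: "x i < x (Suc i)" "0 \<le> x i" if "i < R" for i
    using strict_mono_onD[OF x(1), of i "Suc i"] strict_mono_onD[OF x(1), of 0 i] that x(2)
    by (cases "i = 0"; auto)+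
  have mono: "std_normal_cdf u \<le> std_normal_cdf v" if "u \<le> v" for u v
    using that by (rule std_normal.cdf_nondecreasing)
  have le_1: "std_normal_cdf u \<le> 1" for u
    by (rule std_normal.cdf_bounded_prob)
  have eq: "inner_approx L R b z = min (std_normal_cdf (x R)) (Min (l ` {1..int R}))"
    using z b[of R] by (simp add: inner_approx_def l_def)
  \<comment> \<open>Outside its interval the secant lies above the cdf. Inside, either the squared
    length is at most \<open>\<tau>\<close>, or the secant is at least its left value, already
    within \<open>\<tau>\<close> of 1.\<close>
  have err: "std_normal_cdf z - \<tau> \<le> l (int (Suc i))" if i: "i < R" for i
  proof (cases "x i \<le> z \<and> z \<le> x (Suc i)")
    case True
    then show ?thesis
      using gap[OF i] l[OF i] le_1[of z]
        std_normal_cdf_minus_secant_le[OF step(2,1)[OF i] z]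
        secant_ge_left_value[OF step(2,1)[OF i] z]
      unfolding s_def by fastforce
  next
    case False
    then show ?thesis
      using std_normal_cdf_le_secant[OF step(2,1)[OF i] z] l[OF i] \<open>0 \<le> \<tau>\<close>
      unfolding s_def by fastforce
  qed
  have "std_normal_cdf z - \<tau> \<le> l j" if "j \<in> {1..int R}" for j
    using err[of "nat (j - 1)"] that by (simp add: nat_less_iff Suc_nat_eq_nat_zadd1)
  then have "std_normal_cdf z - \<tau> \<le> Min (l ` {1..int R})"
    using R by (subst Min_ge_iff) auto
  then show "std_normal_cdf z - inner_approx L R b z \<le> \<tau>"
    unfolding eq using end_tail le_1[of z] by auto
  show "0 \<le> std_normal_cdf z - inner_approx L R b z"
  proof (cases "z \<le> x R")
    case True
    then obtain i where i: "i < R" "x i \<le> z" "z \<le> x (Suc i)"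
      using ex_interval_containing[of x z R] x(2) z R by auto
    have "Min (l ` {1..int R}) \<le> l (int (Suc i))"
      using i by (intro Min_le) auto
    also have "\<dots> \<le> std_normal_cdf z"
      using secant_le_std_normal_cdf[OF step(2,1)[OF i(1)] z i(2,3)] l[OF i(1)]
      unfolding s_def by simp
    finally show ?thesis
      unfolding eq by auto
  next
    case False
    then show ?thesis
      unfolding eq using mono[of "x R" z] by auto
  qed
qed

text \<open>The roles are reversed for a maximum: all tangents lie below the cdf by convexity, and
  one good line suffices for the upper bound, namely 0 in the tail and a tangent elsewhere.\<close>

lemma inner_approx_error_neg_side:
  assumes L: "0 < L" and b: "\<And>i. i \<le> L \<Longrightarrow> b (- int i) = - y i"
    and y: "strict_mono_on {0..L} y" "y 0 = 0"
    and gap: "\<And>i. i < L \<Longrightarrow> (y (Suc i) - y i)\<^sup>2 \<le> \<tau> \<or> std_normal_cdf (- y i) \<le> \<tau>"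
    and end_tail: "std_normal_cdf (- y L) \<le> \<tau>" and z: "z < 0"
  shows "0 \<le> std_normal_cdf z - inner_approx L R b z"
    and "std_normal_cdf z - inner_approx L R b z \<le> \<tau>"
proof -
  define l where "l = (\<lambda>i. tangent_slope b i * z + tangent_intercept b i)"
  have l: "l (int i) = std_normal_density (- y i) * z
      + (std_normal_cdf (- y i) - std_normal_density (- y i) * (- y i))" if "i \<le> L" for i
    using b[OF that] by (simp add: l_def tangent_slope_def tangent_intercept_def)
  have y_nonneg: "0 \<le> y i" if "i \<le> L" for i
    using strict_mono_onD[OF y(1), of 0 i] that y(2) by (cases "i = 0") auto
  have mono: "std_normal_cdf u \<le> std_normal_cdf v" if "u \<le> v" for u v
    using that by (rule std_normal.cdf_nondecreasing)
  have eq: "inner_approx L R b z = max 0 (Max (l ` {0..int L}))"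
    using z by (simp add: inner_approx_def l_def)
  have "l (int i) \<le> std_normal_cdf z" if "i \<le> L" for i
    unfolding l[OF that] using y_nonneg[OF that] z by (intro tangent_le_std_normal_cdf) auto
  then have "l j \<le> std_normal_cdf z" if "j \<in> {0..int L}" for j
    using that by (metis atLeastAtMost_iff nat_le_iff nat_0_le)
  then have "Max (l ` {0..int L}) \<le> std_normal_cdf z"
    by (subst Max_le_iff) auto
  then show "0 \<le> std_normal_cdf z - inner_approx L R b z"
    unfolding eq using std_normal.cdf_nonneg[of z] by auto
  show "std_normal_cdf z - inner_approx L R b z \<le> \<tau>"
  proof (cases "- z \<le> y L")
    case True
    then obtain i where i: "i < L" "y i \<le> - z" "- z \<le> y (Suc i)"
      using ex_interval_containing[of y "- z" L] y(2) z L by auto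
    show ?thesis
    proof (cases "std_normal_cdf (- y i) \<le> \<tau>")
      case True
      then show ?thesis
        unfolding eq using mono[of z "- y i"] i by auto
    next
      case False
      then have "(y (Suc i) - y i)\<^sup>2 \<le> \<tau>"
        using gap[OF i(1)] by auto
      \<comment> \<open>Negation reverses the order, so the left end of the interval around
        \<open>z\<close> is \<open>- y (Suc i)\<close>; its tangent is the one used.\<close>
      then have "std_normal_cdf z - l (int (Suc i)) \<le> \<tau>"
        using std_normal_cdf_minus_tangent_le[of "- y (Suc i)" z "y (Suc i) - y i"] i
          l[of "Suc i"] by auto
      moreover have "l (int (Suc i)) \<le> Max (l ` {0..int L})"
        using i by (intro Max_ge) auto
      ultimately show ?thesis
        unfolding eq by linarith
    qed
  next
    case False
    then show ?thesis
      unfolding eq using mono[of z "- y L"] end_tail by auto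
  qed
qed

section \<open>Choice of constants and assembly of the breakpoints\<close>

theorem theorem3:
  shows "\<exists>C \<tau>\<^sub>0 :: real. 0 < C \<and> 0 < \<tau>\<^sub>0 \<and> \<tau>\<^sub>0 < 1 \<and>
    (\<forall>\<tau> zl zr :: real.
       0 < \<tau> \<and> \<tau> \<le> \<tau>\<^sub>0 \<and> zl < 0 \<and> 0 < zr \<and>
       max (1 - std_normal_cdf zr) (std_normal_cdf zl) \<le> \<tau> \<longrightarrow>
       (\<exists>(L :: nat) (R :: nat) (b :: int \<Rightarrow> real).
          valid_breakpoints L R b \<and>
          b (- int L) = zl \<and> b (int R) = zr \<and>
          real (L + R + 1) \<le> C * (1 / sqrt \<tau>) * sqrt (ln (1 / \<tau>)) \<and>
          (\<forall>z :: real.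
             0 \<le> std_normal_cdf z - inner_approx L R b z \<and>
             std_normal_cdf z - inner_approx L R b z \<le> \<tau>)))"
\<comment> \<open>The threshold \<open>exp (- 1)\<close> forces \<open>ln (1 / \<tau>)\<close> to be
  at least 1. This gives \<open>1 \<le> M\<close>, as the tail bounds require, and lets the count
  absorb additive constants.\<close>
proof (rule exI[of _ 9], rule exI[of _ "exp (- 1)"], intro conjI allI impI)
  fix \<tau> zl zr :: real
  assume "0 < \<tau> \<and> \<tau> \<le> exp (- 1) \<and> zl < 0 \<and> 0 < zr \<and>
    max (1 - std_normal_cdf zr) (std_normal_cdf zl) \<le> \<tau>"
  then have \<tau>: "0 < \<tau>" "\<tau> \<le> exp (- 1)" and ends: "0 < - zl" "0 < zr"
    and tails: "1 - std_normal_cdf zr \<le> \<tau>" "std_normal_cdf zl \<le> \<tau>"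
    by auto
  define M where "M = sqrt (2 * ln (1 / \<tau>))"
  have "ln \<tau> \<le> - 1"
    using \<tau> ln_le_cancel_iff[of \<tau> "exp (- 1)"] by simp
  then have ln_ge: "1 \<le> ln (1 / \<tau>)"
    using \<tau> by (simp add: ln_div)
  then have M: "1 \<le> M"
    by (simp add: M_def)
  have exp_M: "exp (- M\<^sup>2 / 2) = \<tau>"
  proof -
    have "M\<^sup>2 = 2 * ln (1 / \<tau>)"
      unfolding M_def using ln_ge by (intro real_sqrt_pow2) simp
    then show ?thesis
      using \<tau> by (simp add: ln_div)
  qed
  have exp_le: "exp (- u\<^sup>2 / 2) \<le> \<tau>" if "M \<le> u" for u
    using power_mono[OF that, of 2] M by (subst exp_M[symmetric]) simp
  have h: "0 < sqrt \<tau>"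
    using \<tau> by simp
  have gap: "u\<^sup>2 \<le> \<tau>" if "u \<le> sqrt \<tau>" "0 \<le> u" for u
    using power_mono[OF that, of 2] \<tau> by simp
  obtain R x where x: "0 < R" "real R \<le> M / sqrt \<tau> + 2" "x 0 = 0" "x R = zr"
      "strict_mono_on {0..R} x"
      "\<And>i. i < R \<Longrightarrow> x (Suc i) - x i \<le> sqrt \<tau> \<or> M \<le> x i"
    using half_line_grid[of "sqrt \<tau>" M zr] h M ends by auto
  obtain L y where y: "0 < L" "real L \<le> M / sqrt \<tau> + 2" "y 0 = 0" "y L = - zl"
      "strict_mono_on {0..L} y"
      "\<And>i. i < L \<Longrightarrow> y (Suc i) - y i \<le> sqrt \<tau> \<or> M \<le> y i"
    using half_line_grid[of "sqrt \<tau>" M "- zl"] h M ends by auto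
  let ?b = "glue x y"
  have valid: "valid_breakpoints L R ?b"
    using x y by (intro valid_breakpoints_glue) auto
  have b_nonneg: "?b (int i) = x i" for i
    by (simp add: glue_def)
  \<comment> \<open>At \<open>i = 0\<close> the value comes from \<open>x\<close>; the two sequences
    agree there because both start at 0.\<close>
  have b_neg: "?b (- int i) = - y i" for i
    using x(3) y(3) by (cases "i = 0") (auto simp: glue_def)
  have count: "real (L + R + 1) \<le> 9 * (1 / sqrt \<tau>) * sqrt (ln (1 / \<tau>))"
  proof -
    \<comment> \<open>Each side has at most \<open>sqrt 2 * q + 2\<close> intervals, so the count is
      at most \<open>4 * q + 5\<close>, and \<open>1 \<le> q\<close> yields the constant 9.\<close>
    define q where "q = (1 / sqrt \<tau>) * sqrt (ln (1 / \<tau>))"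
    have "\<tau> \<le> 1"
      using \<tau>(2) by (rule order_trans) simp
    then have "1 * 1 \<le> q"
      unfolding q_def using ln_ge \<tau> by (intro mult_mono) auto
    moreover have "M / sqrt \<tau> = sqrt 2 * q"
      unfolding M_def q_def real_sqrt_mult by simp
    moreover have "sqrt 2 * q \<le> 2 * q"
      using \<open>1 * 1 \<le> q\<close> real_le_lsqrt[of 2 2] by (intro mult_right_mono) auto
    ultimately have "real (L + R + 1) \<le> 9 * q"
      using x(2) y(2) by linarith
    then show ?thesis
      by (simp add: q_def)
  qed
  \<comment> \<open>A long interval starts at or beyond \<open>M\<close>, where the tail is at most
    \<open>exp (- M\<^sup>2 / 2) = \<tau>\<close>.\<close>
  have gap_x: "(x (Suc i) - x i)\<^sup>2 \<le> \<tau> \<or> 1 - std_normal_cdf (x i) \<le> \<tau>" if "i < R" for i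
    using x(6)[OF that]
  proof
    assume "M \<le> x i"
    then show ?thesis
      using M std_normal_cdf_upper_tail[of "x i"] exp_le[of "x i"] by auto
  qed (use strict_mono_onD[OF x(5), of i "Suc i"] that gap in auto)
  have gap_y: "(y (Suc i) - y i)\<^sup>2 \<le> \<tau> \<or> std_normal_cdf (- y i) \<le> \<tau>" if "i < L" for i
    using y(6)[OF that]
  proof
    assume "M \<le> y i"
    then show ?thesis
      using M std_normal_cdf_lower_tail[of "- y i"] exp_le[of "y i"] by auto
  qed (use strict_mono_onD[OF y(5), of i "Suc i"] that gap in auto)
  have "0 \<le> std_normal_cdf z - inner_approx L R ?b z \<and>
      std_normal_cdf z - inner_approx L R ?b z \<le> \<tau>" for z
  proof (cases "0 \<le> z")
    case True
    then show ?thesis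
      using inner_approx_error_nonneg_side[OF x(1) b_nonneg x(5,3) gap_x] x(4) tails by auto
  next
    case False
    then show ?thesis
      using inner_approx_error_neg_side[OF y(1) b_neg y(5,3) gap_y] y(4) tails by auto
  qed
  then show "\<exists>L R b. valid_breakpoints L R b \<and> b (- int L) = zl \<and> b (int R) = zr \<and>
      real (L + R + 1) \<le> 9 * (1 / sqrt \<tau>) * sqrt (ln (1 / \<tau>)) \<and>
      (\<forall>z. 0 \<le> std_normal_cdf z - inner_approx L R b z \<and>
           std_normal_cdf z - inner_approx L R b z \<le> \<tau>)"
    using valid count x(4) y(4) b_nonneg b_neg by (intro exI[of _ L] exI[of _ R] exI[of _ ?b]) auto
qed auto

end
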